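(* Let $t\in\mathbb{R}$ with $t>0$. An element $(a,b)\in\mathbb{H}_t^{\times}$ is invertible in $\mathbb{H}_t^{\times}$, with inverse $$\left(\frac{\overline{a}}{|a|^{2}-t|b|^{2}},\;\frac{-b}{|a|^{2}-t|b|^{2}}\right)\in\mathbb{H}_t^{\times},$$ if and only if $|a|^{2}\neq t|b|^{2}$, i.e. if and only if $(a,b)$ belongs to the subset $\{(a,b): |a|^{2}\neq t|b|^{2}\}$ of $\mathbb{H}_t^{\times}$. In particular, all elements of $$\{(a,0)\in\mathbb{H}_t: a\in\mathbb{C}^{\times}\}\cup\{(0,b)\in\mathbb{H}_t: b\in\mathbb{C}^{\times}\}$$ are invertible in $\mathbb{H}_t$, where $\mathbb{C}^{\times}=\mathbb{C}\setminus\{0\}$.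
   Context: For $t\in\mathbb{R}$, the $t$-scaled hypercomplex ring is $\mathbb{H}_t=(\mathbb{C}^2,+,\cdot_t)$, where $+$ is the usual vector addition and $(a_1,b_1)\cdot_t(a_2,b_2)=(a_1a_2+tb_1\overline{b_2},\;a_1b_2+b_1\overline{a_2})$, with unity $(1,0)$. Put $\mathbb{H}_t^{\times}=\mathbb{H}_t\setminus\{(0,0)\}$. An element $\xi$ is invertible if there is $\eta$ with $\xi\cdot_t\eta=(1,0)=\eta\cdot_t\xi$. *)

theory Defs
  imports Complex_Main "HOL-Library.Product_Plus" "HOL-Algebra.Ring"
begin

definition hc_mult :: "real \<Rightarrow> complex \<times> complex \<Rightarrow> complex \<times> complex \<Rightarrow> complex \<times> complex" where
  "hc_mult t x y =
     (fst x * fst y + complex_of_real t * snd x * cnj (snd y),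
      fst x * snd y + snd x * cnj (fst y))"

definition hypercomplex_ring :: "real \<Rightarrow> (complex \<times> complex) ring" where
  "hypercomplex_ring t =
     \<lparr>carrier = UNIV, mult = hc_mult t, one = (1, 0), zero = (0, 0), add = (+)\<rparr>"

text \<open>Since this is an associative ring with unity, its invertible elements and their inverses
  are given by \<^const>\<open>Units\<close> and \<^const>\<open>m_inv\<close>.\<close>

lemma ring_hypercomplex_ring: "ring (hypercomplex_ring t)"
proof (rule ringI)
  show "abelian_group (hypercomplex_ring t)"
  proof (rule abelian_groupI)
    fix x assume "x \<in> carrier (hypercomplex_ring t)"
    show "\<exists>y\<in>carrier (hypercomplex_ring t).
            y \<oplus>\<^bsub>hypercomplex_ring t\<^esub> x = \<zero>\<^bsub>hypercomplex_ring t\<^esub>"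
      by (rule bexI[of _ "- x"]) (simp_all add: hypercomplex_ring_def prod_eq_iff)
  qed (simp_all add: hypercomplex_ring_def prod_eq_iff)
  show "monoid (hypercomplex_ring t)"
    by unfold_locales
       (auto simp: hypercomplex_ring_def hc_mult_def prod_eq_iff algebra_simps)
qed (auto simp: hypercomplex_ring_def hc_mult_def prod_eq_iff algebra_simps)

text \<open>The set of nonzero elements. It may contain zero divisors, so in general it is neither
  the group of units nor closed under multiplication.\<close>

definition hc_nonzero :: "real \<Rightarrow> (complex \<times> complex) set" where
  "hc_nonzero t = carrier (hypercomplex_ring t) - {(0, 0)}"

end

theory Submission
  imports Defs
begin

text \<open>Like a quaternion algebra, \<open>\<H>\<^sub>t\<close> has the conjugation \<open>(a, b) \<mapsto> (a\<^sup>*, - b)\<close>, where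
  \<open>a\<^sup>*\<close> is the complex conjugate, and the norm form \<open>N (a, b) = \<bar>a\<bar>\<^sup>2 - t \<bar>b\<bar>\<^sup>2\<close>. An element times
  its conjugate, in either order, is the scalar \<open>N (a, b)\<close>. Hence if the norm is nonzero, the
  conjugate divided by the norm is a two-sided inverse
  (\<open>hc_inverse_of_norm_nonzero\<close>). Conversely the norm is multiplicative (\<open>hc_norm_mult\<close>)
  and takes the value \<open>1\<close> at the unity, so it cannot vanish at an invertible element.
  On the two coordinate axes the norm is \<open>\<bar>a\<bar>\<^sup>2\<close> and \<open>- t \<bar>b\<bar>\<^sup>2\<close>, which vanish only at
  the origin because \<open>t > 0\<close>.\<close>

definition hc_norm :: "real \<Rightarrow> complex \<times> complex \<Rightarrow> real" where
  "hc_norm t x = (cmod (fst x))\<^sup>2 - t * (cmod (snd x))\<^sup>2"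

definition hc_conj :: "complex \<times> complex \<Rightarrow> complex \<times> complex" where
  "hc_conj x = (cnj (fst x), - snd x)"

text \<open>Over the complex numbers the norm is a polynomial in the coordinates and their conjugates,
  so identities about it become ring identities.\<close>

lemma of_real_hc_norm:
  "complex_of_real (hc_norm t x) =
     fst x * cnj (fst x) - complex_of_real t * (snd x * cnj (snd x))"
  by (simp add: hc_norm_def flip: complex_norm_square)

text \<open>Sending \<open>(a, b)\<close> to the matrix with rows \<open>(a, t b)\<close> and \<open>(b\<^sup>*, a\<^sup>*)\<close> respects
  products; the norm is the determinant of this matrix and therefore multiplicative.\<close>

lemma hc_norm_mult: "hc_norm t (hc_mult t x y) = hc_norm t x * hc_norm t y"
proof -
  have "complex_of_real (hc_norm t (hc_mult t x y)) =
        complex_of_real (hc_norm t x * hc_norm t y)"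
    unfolding of_real_mult of_real_hc_norm by (simp add: hc_mult_def algebra_simps)
  then show ?thesis
    by (simp only: of_real_eq_iff)
qed

lemma hc_norm_nonzero_of_Units:
  assumes "x \<in> Units (hypercomplex_ring t)"
  shows "hc_norm t x \<noteq> 0"
proof -
  obtain y where "hc_mult t y x = (1, 0)"
    using assms by (auto simp: Units_def hypercomplex_ring_def)
  then have "hc_norm t y * hc_norm t x = hc_norm t (1, 0)"
    by (simp flip: hc_norm_mult)
  also have "\<dots> = 1"
    by (simp add: hc_norm_def)
  finally show ?thesis
    by auto
qed

lemma hc_mult_conj:
  "hc_mult t x (hc_conj x) = (complex_of_real (hc_norm t x), 0)"
  "hc_mult t (hc_conj x) x = (complex_of_real (hc_norm t x), 0)"
  by (simp_all add: hc_mult_def hc_conj_def of_real_hc_norm algebra_simps)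

text \<open>The product conjugates the coordinates of its right factor in some of its terms, so a
  scalar can be taken out of that factor because it is real.\<close>

lemma hc_mult_divide_of_real:
  "hc_mult t x (fst y / complex_of_real r, snd y / complex_of_real r) =
     (fst (hc_mult t x y) / complex_of_real r, snd (hc_mult t x y) / complex_of_real r)"
  "hc_mult t (fst x / complex_of_real r, snd x / complex_of_real r) y =
     (fst (hc_mult t x y) / complex_of_real r, snd (hc_mult t x y) / complex_of_real r)"
  by (simp_all add: hc_mult_def add_divide_distrib)

lemma hc_inverse_of_norm_nonzero:
  fixes t x
  defines "y \<equiv> (fst (hc_conj x) / complex_of_real (hc_norm t x),
                snd (hc_conj x) / complex_of_real (hc_norm t x))"
  assumes nz: "hc_norm t x \<noteq> 0"
  shows "x \<in> Units (hypercomplex_ring t)"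
    and "inv\<^bsub>hypercomplex_ring t\<^esub> x = y"
proof -
  interpret ring "hypercomplex_ring t"
    by (rule ring_hypercomplex_ring)
  have xy: "hc_mult t x y = (1, 0)" and yx: "hc_mult t y x = (1, 0)"
    using nz by (simp_all add: y_def hc_mult_divide_of_real hc_mult_conj)
  show "x \<in> Units (hypercomplex_ring t)"
    unfolding Units_def using xy yx
    by (auto simp: hypercomplex_ring_def simp del: split_paired_Ex intro!: exI[of _ y])
  show "inv\<^bsub>hypercomplex_ring t\<^esub> x = y"
    by (rule inv_char) (use xy yx in \<open>simp_all add: hypercomplex_ring_def\<close>)
qed

lemma Units_hypercomplex_ring_iff:
  "x \<in> Units (hypercomplex_ring t) \<longleftrightarrow> hc_norm t x \<noteq> 0"
  using hc_norm_nonzero_of_Units hc_inverse_of_norm_nonzero(1) by blast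

theorem theorem13:
  fixes t :: real
  assumes "t > 0"
  shows "(\<forall>a b. (a, b) \<in> hc_nonzero t \<longrightarrow>
           ((a, b) \<in> Units (hypercomplex_ring t) \<longleftrightarrow> (cmod a)\<^sup>2 \<noteq> t * (cmod b)\<^sup>2) \<and>
           ((cmod a)\<^sup>2 \<noteq> t * (cmod b)\<^sup>2 \<longleftrightarrow>
              (a, b) \<in> {(c, d) \<in> hc_nonzero t. (cmod c)\<^sup>2 \<noteq> t * (cmod d)\<^sup>2}) \<and>
           ((cmod a)\<^sup>2 \<noteq> t * (cmod b)\<^sup>2 \<longrightarrow>
              inv\<^bsub>hypercomplex_ring t\<^esub> (a, b) =
                (cnj a / complex_of_real ((cmod a)\<^sup>2 - t * (cmod b)\<^sup>2),
                 - b / complex_of_real ((cmod a)\<^sup>2 - t * (cmod b)\<^sup>2)) \<and>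
              (cnj a / complex_of_real ((cmod a)\<^sup>2 - t * (cmod b)\<^sup>2),
               - b / complex_of_real ((cmod a)\<^sup>2 - t * (cmod b)\<^sup>2)) \<in> hc_nonzero t)) \<and>
         {(a, 0) | a :: complex. a \<noteq> 0} \<union> {(0, b) | b :: complex. b \<noteq> 0}
           \<subseteq> Units (hypercomplex_ring t)"
proof -
  have norm_pair: "hc_norm t (a, b) = (cmod a)\<^sup>2 - t * (cmod b)\<^sup>2" for a b
    by (simp add: hc_norm_def)
  have unit_iff: "(a, b) \<in> Units (hypercomplex_ring t) \<longleftrightarrow> (cmod a)\<^sup>2 \<noteq> t * (cmod b)\<^sup>2" for a b
    by (simp add: Units_hypercomplex_ring_iff norm_pair)
  have inv: "inv\<^bsub>hypercomplex_ring t\<^esub> (a, b) =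
      (cnj a / complex_of_real ((cmod a)\<^sup>2 - t * (cmod b)\<^sup>2),
       - b / complex_of_real ((cmod a)\<^sup>2 - t * (cmod b)\<^sup>2))"
    if "(cmod a)\<^sup>2 \<noteq> t * (cmod b)\<^sup>2" for a b
    using hc_inverse_of_norm_nonzero(2)[of t "(a, b)"] that
    by (simp add: norm_pair hc_conj_def)
  have inv_nonzero: "(cnj a / complex_of_real r, - b / complex_of_real r) \<in> hc_nonzero t"
    if "(a, b) \<in> hc_nonzero t" "r \<noteq> 0" for a b r
    using that by (auto simp: hc_nonzero_def hypercomplex_ring_def)
  have axes: "{(a, 0) | a :: complex. a \<noteq> 0} \<union> {(0, b) | b :: complex. b \<noteq> 0}
      \<subseteq> Units (hypercomplex_ring t)"
    using assms by (auto simp: unit_iff)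
  show ?thesis
  proof (intro conjI allI impI axes)
    fix a b :: complex
    assume nonzero: "(a, b) \<in> hc_nonzero t"
    show "(a, b) \<in> Units (hypercomplex_ring t) \<longleftrightarrow> (cmod a)\<^sup>2 \<noteq> t * (cmod b)\<^sup>2"
      by (rule unit_iff)
    show "(cmod a)\<^sup>2 \<noteq> t * (cmod b)\<^sup>2 \<longleftrightarrow>
        (a, b) \<in> {(c, d) \<in> hc_nonzero t. (cmod c)\<^sup>2 \<noteq> t * (cmod d)\<^sup>2}"
      using nonzero by simp
    assume ne: "(cmod a)\<^sup>2 \<noteq> t * (cmod b)\<^sup>2"
    show "inv\<^bsub>hypercomplex_ring t\<^esub> (a, b) =
        (cnj a / complex_of_real ((cmod a)\<^sup>2 - t * (cmod b)\<^sup>2),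
         - b / complex_of_real ((cmod a)\<^sup>2 - t * (cmod b)\<^sup>2))"
      using ne by (rule inv)
    show "(cnj a / complex_of_real ((cmod a)\<^sup>2 - t * (cmod b)\<^sup>2),
        - b / complex_of_real ((cmod a)\<^sup>2 - t * (cmod b)\<^sup>2)) \<in> hc_nonzero t"
      using nonzero ne by (intro inv_nonzero) simp_all
  qed
qed

end
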